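(* Let $p$ be an odd prime number which is not a Fermat prime number. Let $n$ be a positive integer and let $q$ be an odd prime divisor of $p-1$. Then there exists a singular simple solution $(X,r)$ of the YBE of cardinality $p^{2n}$. Furthermore, $|\mathcal{G}(X,r)|=p^mq$ for some positive integer $m$. (That is, there exists a singular simple solution $(X,r)$ with $|X|=p^{2n}$ and $|\mathcal{G}(X,r)|=p^mq$ for some positive integer $m$.)
   Context: A solution of the YBE means an involutive, non-degenerate, set-theoretic solution of the Yang--Baxter equation: a pair $(X,r)$ where $X$ is a non-empty set and $r\colon X\times X\to X\times X$ is a map, written $r(x,y)=(\sigma_x(y),\gamma_y(x))$, such that $r^2=\mathrm{id}$, all maps $\sigma_x,\gamma_y\colon X\to X$ are bijective, and $r_{12}r_{23}r_{12}=r_{23}r_{12}r_{23}$ on $X^3$, where $r_{12}=r\times \mathrm{id}_X$ and $r_{23}=\mathrm{id}_X\times r$. The permutation group of $(X,r)$ is the subgroup $\mathcal{G}(X,r)$ of the symmetric group on $X$ generated by all $\sigma_x$, $x\in X$ (it carries a natural left brace structure, with composition as multiplicative operation). The solution $(X,r)$ is indecomposable if $\mathcal{G}(X,r)$ acts transitively on $X$. A homomorphism of solutions $f\colon (X,r)\to (Y,s)$, with $r(x,y)=(\sigma_x(y),\gamma_y(x))$ and $s(t,z)=(\sigma'_t(z),\gamma'_z(t))$, is a map $f\colon X\to Y$ such that $f(\sigma_x(y))=\sigma'_{f(x)}(f(y))$ and $f(\gamma_y(x))=\gamma'_{f(y)}(f(x))$ for all $x,y\in X$. An epimorphism is a surjective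 homomorphism; an isomorphism is a bijective homomorphism. A solution $(X,r)$ is simple if $|X|>1$ and for every epimorphism of solutions $f\colon (X,r)\to (Y,s)$ either $f$ is an isomorphism or $|Y|=1$. Singular: a prime divisor $\ell$ of the order of a finite left brace $B$ is called singular if there exists a finite indecomposable solution $(X,r)$ of the YBE such that $B\cong\mathcal{G}(X,r)$ as left braces and $\ell$ does not divide $|X|$; in this case the solution $(X,r)$ is called singular. Thus a finite indecomposable solution $(X,r)$ is singular if some prime divisor of $|\mathcal{G}(X,r)|$ does not divide $|X|$. *)

theory Defs
  imports
    "HOL-Algebra.Group_Action"
    "HOL-Algebra.Generated_Groups"
    "HOL-Computational_Algebra.Primes"
begin

text \<open>
  A set-theoretic solution lives on an explicit carrier \<open>X\<close>; the values of \<open>r\<close> outside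
  \<open>X \<times> X\<close> are irrelevant. We write \<open>r (x, y) = (lmap r x y, rmap r y x)\<close>, so
  \<open>lmap r x\<close> is \<open>\<sigma>\<^sub>x\<close> and \<open>rmap r y\<close> is \<open>\<gamma>\<^sub>y\<close>.
\<close>

definition lmap :: "('a \<times> 'a \<Rightarrow> 'a \<times> 'a) \<Rightarrow> 'a \<Rightarrow> 'a \<Rightarrow> 'a" where
  "lmap r x y = fst (r (x, y))"

definition rmap :: "('a \<times> 'a \<Rightarrow> 'a \<times> 'a) \<Rightarrow> 'a \<Rightarrow> 'a \<Rightarrow> 'a" where
  "rmap r y x = snd (r (x, y))"

definition act12 :: "('a \<times> 'a \<Rightarrow> 'a \<times> 'a) \<Rightarrow> 'a \<times> 'a \<times> 'a \<Rightarrow> 'a \<times> 'a \<times> 'a" where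
  "act12 r = (\<lambda>(x, y, z). (fst (r (x, y)), snd (r (x, y)), z))"

definition act23 :: "('a \<times> 'a \<Rightarrow> 'a \<times> 'a) \<Rightarrow> 'a \<times> 'a \<times> 'a \<Rightarrow> 'a \<times> 'a \<times> 'a" where
  "act23 r = (\<lambda>(x, y, z). (x, r (y, z)))"

definition ybe_solution :: "'a set \<Rightarrow> ('a \<times> 'a \<Rightarrow> 'a \<times> 'a) \<Rightarrow> bool" where
  "ybe_solution X r \<longleftrightarrow>
     X \<noteq> {} \<and>
     r \<in> X \<times> X \<rightarrow> X \<times> X \<and>
     (\<forall>p \<in> X \<times> X. r (r p) = p) \<and>
     (\<forall>x \<in> X. bij_betw (lmap r x) X X) \<and>
     (\<forall>y \<in> X. bij_betw (rmap r y) X X) \<and>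
     (\<forall>t \<in> X \<times> X \<times> X.
        act12 r (act23 r (act12 r t)) = act23 r (act12 r (act23 r t)))"

text \<open>
  The maps \<open>\<sigma>\<^sub>x\<close> are restricted to \<open>X\<close> because \<^term>\<open>BijGroup X\<close>, the symmetric group
  on \<open>X\<close>, consists of extensional functions.
\<close>

definition perm_group :: "'a set \<Rightarrow> ('a \<times> 'a \<Rightarrow> 'a \<times> 'a) \<Rightarrow> ('a \<Rightarrow> 'a) monoid" where
  "perm_group X r =
     (BijGroup X)\<lparr>carrier := generate (BijGroup X) ((\<lambda>x. restrict (lmap r x) X) ` X)\<rparr>"

definition indecomposable_solution :: "'a set \<Rightarrow> ('a \<times> 'a \<Rightarrow> 'a \<times> 'a) \<Rightarrow> bool" where
  "indecomposable_solution X r \<longleftrightarrow>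
     ybe_solution X r \<and> transitive_action (perm_group X r) X (\<lambda>g. g)"

definition solution_hom ::
  "'a set \<Rightarrow> ('a \<times> 'a \<Rightarrow> 'a \<times> 'a) \<Rightarrow> 'b set \<Rightarrow> ('b \<times> 'b \<Rightarrow> 'b \<times> 'b) \<Rightarrow> ('a \<Rightarrow> 'b) \<Rightarrow> bool"
  where
  "solution_hom X r Y s f \<longleftrightarrow>
     f \<in> X \<rightarrow> Y \<and>
     (\<forall>x \<in> X. \<forall>y \<in> X. f (lmap r x y) = lmap s (f x) (f y) \<and>
                     f (rmap r y x) = rmap s (f y) (f x))"

definition solution_epi ::
  "'a set \<Rightarrow> ('a \<times> 'a \<Rightarrow> 'a \<times> 'a) \<Rightarrow> 'b set \<Rightarrow> ('b \<times> 'b \<Rightarrow> 'b \<times> 'b) \<Rightarrow> ('a \<Rightarrow> 'b) \<Rightarrow> bool"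
  where
  "solution_epi X r Y s f \<longleftrightarrow> solution_hom X r Y s f \<and> f ` X = Y"

definition solution_iso ::
  "'a set \<Rightarrow> ('a \<times> 'a \<Rightarrow> 'a \<times> 'a) \<Rightarrow> 'b set \<Rightarrow> ('b \<times> 'b \<Rightarrow> 'b \<times> 'b) \<Rightarrow> ('a \<Rightarrow> 'b) \<Rightarrow> bool"
  where
  "solution_iso X r Y s f \<longleftrightarrow> solution_hom X r Y s f \<and> bij_betw f X Y"

text \<open>
  The targets \<open>Y\<close> range over subsets of the type of \<open>X\<close>. This is no restriction: an epimorphic
  image of \<open>X\<close> can be transported to a set of representatives inside \<open>X\<close>, and
  \<open>simple_solution_epi\<close> below gives the property for targets of any type. The first conjunct
  says \<open>|X| > 1\<close>; \<open>card\<close> is 0 on infinite sets, hence the disjunction.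
\<close>

definition simple_solution :: "'a set \<Rightarrow> ('a \<times> 'a \<Rightarrow> 'a \<times> 'a) \<Rightarrow> bool" where
  "simple_solution X r \<longleftrightarrow>
     ybe_solution X r \<and>
     (infinite X \<or> card X > 1) \<and>
     (\<forall>(Y :: 'a set) s f. ybe_solution Y s \<and> solution_epi X r Y s f \<longrightarrow>
        solution_iso X r Y s f \<or> card Y = 1)"

text \<open>
  A finite left brace \<open>B\<close> isomorphic to \<open>\<G>(X,r)\<close> enters the notion of a singular solution
  \<open>(X,r)\<close> only through its order, which is that of \<open>\<G>(X,r)\<close>.
\<close>

definition singular_solution :: "'a set \<Rightarrow> ('a \<times> 'a \<Rightarrow> 'a \<times> 'a) \<Rightarrow> bool" where
  "singular_solution X r \<longleftrightarrow>
     finite X \<and> indecomposable_solution X r \<and>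
     (\<exists>l :: nat. prime l \<and> l dvd order (perm_group X r) \<and> \<not> l dvd card X)"

definition fermat_prime :: "nat \<Rightarrow> bool" where
  "fermat_prime p \<longleftrightarrow> prime p \<and> (\<exists>k. p = 2 ^ (2 ^ k) + 1)"

lemma perm_group_action:
  assumes "ybe_solution X r"
  shows "group_action (perm_group X r) X (\<lambda>g. g)"
proof -
  interpret B: group "BijGroup X" by (rule group_BijGroup)
  have "(\<lambda>x. restrict (lmap r x) X) ` X \<subseteq> carrier (BijGroup X)"
    using assms by (auto simp: ybe_solution_def BijGroup_def Bij_def)
  then have sub: "subgroup (generate (BijGroup X) ((\<lambda>x. restrict (lmap r x) X) ` X)) (BijGroup X)"
    by (rule B.generate_is_subgroup)
  then have grp: "group (perm_group X r)"
    unfolding perm_group_def by (rule B.subgroup_imp_group)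
  have "(\<lambda>g. g) \<in> hom (perm_group X r) (BijGroup X)"
    using subgroup.subset[OF sub] by (auto simp: hom_def perm_group_def)
  with grp show ?thesis
    by (simp add: group_action_def group_hom_def group_hom_axioms_def group_BijGroup)
qed

lemma indecomposable_solution_iff:
  "indecomposable_solution X r \<longleftrightarrow>
     ybe_solution X r \<and> (\<forall>x \<in> X. \<forall>y \<in> X. \<exists>g \<in> carrier (perm_group X r). g x = y)"
  by (auto simp: indecomposable_solution_def transitive_action_def
      transitive_action_axioms_def perm_group_action)

lemma simple_solution_epi:
  fixes X :: "'a set" and Y :: "'b set"
  assumes simp: "simple_solution X r" and Y: "ybe_solution Y s" and epi: "solution_epi X r Y s f"
  shows "solution_iso X r Y s f \<or> card Y = 1"
proof -
  define h where "h = inv_into X f"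
  define Z where "Z = h ` Y"
  define t where "t = (\<lambda>(a, b). map_prod h h (s (f a, f b)))"
  have hom: "solution_hom X r Y s f" and im: "f ` X = Y"
    using epi by (auto simp: solution_epi_def)
  have fh [simp]: "f (h y) = y" if "y \<in> Y" for y
    using that im by (simp add: h_def f_inv_into_f)
  have hZ: "bij_betw h Y Z"
    unfolding Z_def by (intro bij_betw_imageI inj_on_inverseI[of _ f]) auto
  have fZ: "bij_betw f Z Y"
    by (intro bij_betwI[where g = h]) (auto simp: Z_def)
  have cl: "s (y, z) \<in> Y \<times> Y" if "y \<in> Y" "z \<in> Y" for y z
    using Y that by (auto simp: ybe_solution_def)
  have l: "lmap t a b = h (lmap s (f a) (f b))" and rr: "rmap t a b = h (rmap s (f a) (f b))" for a b
    by (simp_all add: lmap_def rmap_def t_def)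
  have t: "t (h y, h z) = map_prod h h (s (y, z))" if "y \<in> Y" "z \<in> Y" for y z
    using that by (simp add: t_def)
  have solZ: "ybe_solution Z t"
    unfolding ybe_solution_def
  proof (intro conjI ballI)
    show "Z \<noteq> {}" using Y by (simp add: Z_def ybe_solution_def)
    show "t \<in> Z \<times> Z \<rightarrow> Z \<times> Z"
    proof
      fix p assume "p \<in> Z \<times> Z"
      then obtain y z where yz: "y \<in> Y" "z \<in> Y" "p = (h y, h z)" by (auto simp: Z_def)
      with cl[of y z] t[of y z] show "t p \<in> Z \<times> Z" by (cases "s (y, z)") (auto simp: Z_def)
    qed
    show "t (t p) = p" if "p \<in> Z \<times> Z" for p
    proof -
      from that obtain y z where yz: "y \<in> Y" "z \<in> Y" "p = (h y, h z)" by (auto simp: Z_def)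
      obtain u v where uv: "s (y, z) = (u, v)" by force
      have "s (u, v) = (y, z)" using Y yz uv unfolding ybe_solution_def by (metis SigmaI)
      with cl[of y z] yz uv show ?thesis by (simp add: t)
    qed
    show "bij_betw (lmap t a) Z Z" if "a \<in> Z" for a
    proof -
      have "bij_betw (lmap s (f a)) Y Y"
        using bij_betwE[OF fZ] that Y by (simp add: ybe_solution_def)
      from bij_betw_trans[OF bij_betw_trans[OF fZ this] hZ] show ?thesis
        by (rule bij_betw_cong[THEN iffD1, rotated]) (simp add: l)
    qed
    show "bij_betw (rmap t a) Z Z" if "a \<in> Z" for a
    proof -
      have "bij_betw (rmap s (f a)) Y Y"
        using bij_betwE[OF fZ] that Y by (simp add: ybe_solution_def)
      from bij_betw_trans[OF bij_betw_trans[OF fZ this] hZ] show ?thesis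
        by (rule bij_betw_cong[THEN iffD1, rotated]) (simp add: rr)
    qed
    define H where "H = (\<lambda>(x, y, z). (h x, h y, h z))"
    have a12: "act12 t (H w) = H (act12 s w)" "act12 s w \<in> Y \<times> Y \<times> Y"
      and a23: "act23 t (H w) = H (act23 s w)" "act23 s w \<in> Y \<times> Y \<times> Y"
      if "w \<in> Y \<times> Y \<times> Y" for w
    proof -
      obtain x y z where w: "w = (x, y, z)" "x \<in> Y" "y \<in> Y" "z \<in> Y" using \<open>w \<in> _\<close> by auto
      show "act12 t (H w) = H (act12 s w)" "act12 s w \<in> Y \<times> Y \<times> Y"
        "act23 t (H w) = H (act23 s w)" "act23 s w \<in> Y \<times> Y \<times> Y"
        using w cl[of x y] cl[of y z]
        by (auto simp: act12_def act23_def H_def t mem_Times_iff map_prod_def split: prod.splits)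
    qed
    show "act12 t (act23 t (act12 t w)) = act23 t (act12 t (act23 t w))"
      if "w \<in> Z \<times> Z \<times> Z" for w
    proof -
      from that obtain w' where w': "w' \<in> Y \<times> Y \<times> Y" "w = H w'"
        by (force simp: Z_def H_def)
      have "act12 s (act23 s (act12 s w')) = act23 s (act12 s (act23 s w'))"
        using Y w'(1) unfolding ybe_solution_def by blast
      with w' show ?thesis by (simp add: a12 a23)
    qed
  qed
  have "solution_epi X r Z t (h \<circ> f)"
    using hom im by (auto simp: solution_epi_def solution_hom_def l rr Z_def image_comp[symmetric])
  with simp solZ have "bij_betw (h \<circ> f) X Z \<or> card Z = 1"
    unfolding simple_solution_def solution_iso_def by blast
  moreover have "card Z = card Y" using hZ by (simp add: bij_betw_same_card)
  moreover have "inj_on f X" if "bij_betw (h \<circ> f) X Z"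
    using that by (metis bij_betw_imp_inj_on inj_on_imageI2)
  ultimately show ?thesis
    using hom im by (auto simp: solution_iso_def bij_betw_def)
qed

end

theory Submission
  imports Defs "HOL-Number_Theory.Number_Theory"
begin

text \<open>
  Let \<open>N = p\<^sup>n\<close> and let \<open>\<alpha>\<close> be a unit modulo \<open>N\<close> of order \<open>q\<close> with \<open>\<alpha> \<noteq> 1\<close> modulo \<open>p\<close> and
  \<open>\<beta> = \<alpha>\<^sup>-\<^sup>1\<close>. Let \<open>j\<close> be the even function on \<open>\<int>/N\<close> with \<open>j (\<plusminus> \<alpha>\<^sup>i) = \<alpha>\<^sup>i\<close> that vanishes
  elsewhere, so that \<open>j (\<beta> t) = \<beta> j t\<close>. On pairs of residues modulo \<open>N\<close> the operation
  \<open>(a, b) \<cdot> (c, e) = (\<beta> c + b, \<beta> e + j (c - a))\<close> satisfies the cycle set identity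
  \<open>(x \<cdot> y) \<cdot> (x \<cdot> z) = (y \<cdot> x) \<cdot> (y \<cdot> z)\<close>, so the maps \<open>\<sigma>\<^sub>x\<close> inverse to \<open>y \<mapsto> x \<cdot> y\<close> define a
  solution. Its permutation group consists of maps
  \<open>(c, e) \<mapsto> (\<alpha>\<^sup>i c + u, \<alpha>\<^sup>i e + f c)\<close>; these form a group of order \<open>q N\<^bsup>N+1\<^esup>\<close>. Both
  \<open>p\<close> and \<open>q\<close> divide the order of the permutation group, by transitivity and by the action on
  the first coordinate. A nontrivial congruence of the solution identifies some \<open>(u, v)\<close> with
  some \<open>(u, v + w)\<close>, \<open>w \<noteq> 0\<close>; the set of all such \<open>w\<close> is a subgroup of \<open>\<int>/N\<close> that contains the
  differences \<open>j (t + w) - j t\<close>. If it had only multiples of \<open>p\<close>, then \<open>j (1 + w) = 0\<close> and it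
  would contain \<open>0 - j 1 = -1\<close>; so it contains a unit and everything is identified.
\<close>

section \<open>Cycle sets\<close>

text \<open>Rump's passage from cycle sets to solutions, \<open>s x\<close> being the inverse of
  \<open>d x\<close>. The cycle identity yields \<open>ss\<close>, which carries the braid relation.
  Injectivity of the square map makes each \<open>rmap r y\<close> injective, hence bijective since
  \<open>X\<close> is finite.\<close>

lemma ybe_solution_of_cycle_set:
  fixes d s :: "'a \<Rightarrow> 'a \<Rightarrow> 'a"
  assumes fin: "finite X" and ne: "X \<noteq> {}"
    and dcl: "\<And>x y. x \<in> X \<Longrightarrow> y \<in> X \<Longrightarrow> d x y \<in> X"
    and scl: "\<And>x y. x \<in> X \<Longrightarrow> y \<in> X \<Longrightarrow> s x y \<in> X"
    and sd: "\<And>x y. x \<in> X \<Longrightarrow> y \<in> X \<Longrightarrow> s x (d x y) = y"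
    and ds: "\<And>x y. x \<in> X \<Longrightarrow> y \<in> X \<Longrightarrow> d x (s x y) = y"
    and cyc: "\<And>x y z. x \<in> X \<Longrightarrow> y \<in> X \<Longrightarrow> z \<in> X \<Longrightarrow> d (d x y) (d x z) = d (d y x) (d y z)"
    and diag: "inj_on (\<lambda>x. d x x) X"
  shows "ybe_solution X (\<lambda>(x, y). (s x y, d (s x y) x))"
proof -
  define g where "g x y = d (s x y) x" for x y
  define r where "r = (\<lambda>(x, y). (s x y, g x y))"
  have gcl: "g x y \<in> X" if "x \<in> X" "y \<in> X" for x y
    using that by (simp add: g_def dcl scl)
  have sg: "s (s x y) (g x y) = x" if "x \<in> X" "y \<in> X" for x y
    using that by (simp add: g_def sd scl)
  have gg: "g (s x y) (g x y) = y" if "x \<in> X" "y \<in> X" for x y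
    using that by (simp add: g_def[of "s x y"] sg ds)
  have cyc': "d y (d x w) = d (g x y) (d (s x y) w)" if "x \<in> X" "y \<in> X" "w \<in> X" for x y w
    using cyc[of x "s x y" w] that by (simp add: scl ds g_def)
  have ss: "s x (s y z) = s (s x y) (s (g x y) z)" if "x \<in> X" "y \<in> X" "z \<in> X" for x y z
  proof -
    define w where "w = s (s x y) (s (g x y) z)"
    have w: "w \<in> X" using that by (simp add: w_def scl gcl)
    have "d y (d x w) = z"
      using cyc'[OF that(1,2) w] that by (simp add: w_def ds scl gcl)
    then have "s y z = d x w" using sd[of y "d x w"] that w by (simp add: dcl)
    then show ?thesis using sd[of x w] that w by (simp add: w_def)
  qed
  \<comment> \<open>In the coordinates \<open>U\<close> the maps \<open>r\<^sub>1\<^sub>2\<close> and \<open>r\<^sub>2\<^sub>3\<close> act as adjacent transpositions.\<close>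
  define U where "U = (\<lambda>(x, y, z). (x, s x y, s x (s y z)))"
  have s_inj: "y = y'" if "s x y = s x y'" "x \<in> X" "y \<in> X" "y' \<in> X" for x y y'
    using that by (metis ds)
  have U_inj: "inj_on U (X \<times> X \<times> X)"
  proof (rule inj_onI)
    fix t t' assume "t \<in> X \<times> X \<times> X" "t' \<in> X \<times> X \<times> X" "U t = U t'"
    moreover obtain x y z x' y' z' where "t = (x, y, z)" "t' = (x', y', z')" by (metis prod_cases3)
    ultimately show "t = t'" using s_inj scl by (simp add: U_def) metis
  qed
  have U12: "U (act12 r t) = (\<lambda>(a, b, c). (b, a, c)) (U t)" "act12 r t \<in> X \<times> X \<times> X"
    and U23: "U (act23 r t) = (\<lambda>(a, b, c). (a, c, b)) (U t)" "act23 r t \<in> X \<times> X \<times> X"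
    if "t \<in> X \<times> X \<times> X" for t
    using that by (auto simp: U_def act12_def act23_def r_def scl gcl sg ss[symmetric])
  have "ybe_solution X r"
    unfolding ybe_solution_def
  proof (intro conjI ballI)
    show "X \<noteq> {}" by fact
    show "r \<in> X \<times> X \<rightarrow> X \<times> X" by (auto simp: r_def scl gcl)
    show "r (r w) = w" if "w \<in> X \<times> X" for w
      using that by (auto simp: r_def sg gg)
    show "bij_betw (lmap r x) X X" if "x \<in> X" for x
      by (rule bij_betwI[where g = "d x"]) (use that in \<open>auto simp: lmap_def r_def sd ds scl dcl\<close>)
    show "bij_betw (rmap r y) X X" if y: "y \<in> X" for y
    proof -
      have "inj_on (\<lambda>x. g x y) X"
      proof (rule inj_onI)
        fix x x' assume x: "x \<in> X" "x' \<in> X" "g x y = g x' y"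
        \<comment> \<open>For fixed \<open>y\<close> the value \<open>g z y\<close> thus determines
          the square \<open>d z z\<close>.\<close>
        have "d y (d z z) = d (g z y) (g z y)" if "z \<in> X" for z
          using cyc'[OF that y that] by (simp add: g_def)
        with x have "d y (d x x) = d y (d x' x')" by simp
        then have "d x x = d x' x'" using sd y x dcl by metis
        then show "x = x'" using diag x by (auto dest: inj_onD)
      qed
      moreover have "(\<lambda>x. g x y) ` X \<subseteq> X" using y by (auto simp: gcl)
      ultimately have "bij_betw (\<lambda>x. g x y) X X"
        by (simp add: bij_betw_def endo_inj_surj[OF fin])
      then show ?thesis by (simp add: rmap_def[abs_def] r_def)
    qed
    show "act12 r (act23 r (act12 r t)) = act23 r (act12 r (act23 r t))" if "t \<in> X \<times> X \<times> X" for t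
      by (rule inj_onD[OF U_inj]) (simp_all add: U12 U23 that split: prod.splits)
  qed
  then show ?thesis by (simp add: r_def g_def)
qed

section \<open>Roots of unity modulo a prime power\<close>

lemma ex_root_of_unity_mod_prime_power:
  fixes p q n :: nat
  assumes p: "prime p" and q: "prime q" "q dvd p - 1"
  shows "\<exists>a :: int. [a ^ q = 1] (mod int p ^ n) \<and> \<not> [a = 1] (mod int p)"
proof (cases "n = 0")
  case True
  have "\<not> [0 = 1] (mod int p)" using prime_gt_1_nat[OF p] by (simp add: cong_0_1_int)
  with True show ?thesis using q(1) by (intro exI[of _ 0]) (simp add: cong_def)
next
  case False
  obtain g where g: "residue_primroot p g" using prime_primitive_root_exists[OF prime_gt_1_nat[OF p] p] by blast
  then have cop: "coprime p g" and og: "ord p g = p - 1"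
    using p by (auto simp: residue_primroot_def totient_prime)
  obtain k where k: "p - 1 = q * k" using q(2) by blast
  \<comment> \<open>The exponent is the totient of \<open>p ^ n\<close> divided by \<open>q\<close>,
    so Euler's theorem gives the \<open>q\<close>-th power. Modulo \<open>p\<close> the order of
    \<open>g\<close> is \<open>q * k\<close>, and \<open>q\<close> does not divide
    \<open>p ^ (n - 1)\<close>, so \<open>a\<close> stays nontrivial there.\<close>
  define a where "a = g ^ (k * p ^ (n - 1))"
  have "totient (p ^ n) = p ^ (n - 1) * (p - 1)"
    using totient_prime_power[OF p, of n] False by simp
  then have "k * p ^ (n - 1) * q = totient (p ^ n)"
    by (simp only: k mult_ac)
  then have "a ^ q = g ^ totient (p ^ n)"
    by (simp only: a_def power_mult[symmetric])
  then have "[a ^ q = 1] (mod p ^ n)"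
    using euler_theorem[of g "p ^ n"] cop by (simp add: coprime_commute)
  moreover have "\<not> [a = 1] (mod p)"
  proof
    assume "[a = 1] (mod p)"
    then have "q * k dvd k * p ^ (n - 1)" unfolding a_def ord_divides og k .
    moreover have "k > 0" using k p prime_gt_1_nat[of p] by (cases k) auto
    ultimately have "q dvd p ^ (n - 1)" by (simp add: mult.commute)
    then have "q dvd p" using q(1) prime_dvd_power by blast
    then have "q dvd 1" using q(2) p prime_gt_1_nat[of p] by (metis One_nat_def Suc_diff_1 dvd_add_right_iff plus_1_eq_Suc add.commute prime_gt_0_nat)
    with q(1) show False by simp
  qed
  ultimately show ?thesis
    by (intro exI[of _ "int a"]) (simp flip: cong_int_iff)
qed

lemma BijGroup_mult: "g \<in> Bij S \<Longrightarrow> h \<in> Bij S \<Longrightarrow> g \<otimes>\<^bsub>BijGroup S\<^esub> h = compose S g h"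
  by (simp add: BijGroup_def)

lemma BijGroup_one: "\<one>\<^bsub>BijGroup S\<^esub> = (\<lambda>x \<in> S. x)"
  by (simp add: BijGroup_def)

section \<open>Residues modulo \<open>N\<close>, the root of unity \<alpha> and the function
  \<open>j\<close>\<close>

locale scalar_root =
  fixes p n q :: nat and \<alpha> \<beta> :: int
  assumes p: "prime p" "odd p" and n: "n > 0" and q: "prime q" "odd q" "q \<noteq> p"
    and \<alpha>q: "[\<alpha> ^ q = 1] (mod int p ^ n)" and \<alpha>1: "\<not> [\<alpha> = 1] (mod int p)"
    and \<alpha>\<beta>: "[\<alpha> * \<beta> = 1] (mod int p ^ n)"
begin

abbreviation N :: int where "N \<equiv> int p ^ n"

abbreviation eqN :: "int \<Rightarrow> int \<Rightarrow> bool" (infix "\<doteq>" 50) where "a \<doteq> b \<equiv> [a = b] (mod N)"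

lemma p_gt_2: "p > 2"
  using p prime_gt_1_nat[of p] by (cases "p = 2") auto

lemma N_gt_1: "N > 1"
  using p_gt_2 n by (simp add: one_less_power)

lemma cong_p: "a \<doteq> b \<Longrightarrow> [a = b] (mod int p)"
  using n by (meson cong_dvd_modulus dvd_power)

lemma p_dvd_iff_not_coprime: "int p dvd a \<longleftrightarrow> \<not> coprime a N"
proof -
  have "prime (int p)" using p(1) by simp
  then show ?thesis using n prime_imp_coprime[of "int p" a] not_prime_unit coprime_absorb_left[of "int p" a]
    by (auto simp: coprime_commute[of a])
qed

lemma two_unit: "2 * a \<doteq> 0 \<longleftrightarrow> a \<doteq> 0"
proof -
  have "coprime 2 N" using p by (simp add: coprime_right_2_iff_odd coprime_left_2_iff_odd)
  then show ?thesis using cong_mult_lcancel[of 2 N a 0] by simp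
qed

lemma \<alpha>_pow_iff: "\<alpha> ^ i \<doteq> 1 \<longleftrightarrow> q dvd i"
proof
  assume "q dvd i"
  then obtain k where "i = q * k" by blast
  then show "\<alpha> ^ i \<doteq> 1" using cong_pow[OF \<alpha>q, of k] by (simp add: power_mult)
next
  assume i: "\<alpha> ^ i \<doteq> 1"
  show "q dvd i"
  proof (rule ccontr)
    assume "\<not> q dvd i"
    then have "coprime q i" using q(1) by (simp add: prime_imp_coprime)
    \<comment> \<open>By Bezout \<alpha> would be a quotient of powers of
      \<open>\<alpha> ^ q\<close> and \<open>\<alpha> ^ i\<close>, both trivial.\<close>
    then obtain x y where xy: "q * x = i * y + 1"
      using bezout_nat[of q i] q(1) by (metis coprime_imp_gcd_eq_1 not_prime_0)
    have "\<alpha> ^ (q * x) \<doteq> 1" using cong_pow[OF \<alpha>q, of x] by (simp add: power_mult)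
    moreover have "\<alpha> ^ (i * y + 1) \<doteq> \<alpha>" using cong_mult[OF cong_pow[OF i, of y] cong_refl[of \<alpha>]] by (simp add: power_mult mult.commute)
    ultimately have "\<alpha> \<doteq> 1" using xy by (metis cong_sym cong_trans)
    with \<alpha>1 cong_p show False by blast
  qed
qed

lemma \<alpha>\<beta>_cancel [simp]: "\<alpha> * (\<beta> * t) \<doteq> t" "\<beta> * (\<alpha> * t) \<doteq> t"
  using cong_mult[OF \<alpha>\<beta> cong_refl[of t]] by (simp_all add: mult_ac)

lemma \<beta>q: "\<beta> ^ q \<doteq> 1"
proof -
  have "\<alpha> ^ q * \<beta> ^ q \<doteq> 1" using cong_pow[OF \<alpha>\<beta>, of q] by (simp add: power_mult_distrib)
  moreover have "\<alpha> ^ q * \<beta> ^ q \<doteq> 1 * \<beta> ^ q" by (intro cong_mult \<alpha>q cong_refl)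
  ultimately show ?thesis by (metis cong_sym cong_trans mult_1)
qed

text \<open>
  If \<open>t = \<plusminus> \<alpha>\<^sup>i\<close>, then \<open>t\<^bsup>2q\<^esup> = 1\<close> and \<open>t\<^bsup>q+1\<^esup> = \<alpha>\<^sup>i\<close>, because \<open>q\<close> is odd; this gives the
  even and \<open>\<beta>\<close>-homogeneous function \<open>j\<close> by a formula.
\<close>

definition j :: "int \<Rightarrow> int" where
  "j t = (if t ^ (2 * q) \<doteq> 1 then t ^ (q + 1) else 0)"

lemma j_cong:
  assumes "t \<doteq> t'"
  shows "j t \<doteq> j t'"
proof -
  have "t ^ (2 * q) \<doteq> 1 \<longleftrightarrow> t' ^ (2 * q) \<doteq> 1"
    using cong_pow[OF assms, of "2 * q"] by (meson cong_sym cong_trans)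
  then show ?thesis using cong_pow[OF assms, of "q + 1"] by (auto simp only: j_def cong_refl if_True if_False)
qed

lemma j_minus [simp]: "j (- t) = j t"
  using q(2) by (simp add: j_def)

lemma j_\<beta>: "j (\<beta> * t) \<doteq> \<beta> * j t"
proof -
  have "\<beta> ^ (2 * q) \<doteq> 1" using cong_pow[OF \<beta>q, of 2] by (simp add: power_mult[symmetric] mult.commute)
  then have "(\<beta> * t) ^ (2 * q) \<doteq> t ^ (2 * q)"
    using cong_mult[OF _ cong_refl[of "t ^ (2 * q)"]] by (fastforce simp: power_mult_distrib)
  then have 1: "(\<beta> * t) ^ (2 * q) \<doteq> 1 \<longleftrightarrow> t ^ (2 * q) \<doteq> 1"
    by (meson cong_sym cong_trans)
  have "(\<beta> * t) ^ (q + 1) = \<beta> ^ q * (\<beta> * t ^ (q + 1))" by (simp add: power_mult_distrib mult_ac)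
  also have "\<dots> \<doteq> 1 * (\<beta> * t ^ (q + 1))" by (intro cong_mult \<beta>q cong_refl)
  finally show ?thesis by (simp add: j_def 1)
qed

lemma j_0 [simp]: "j 0 = 0" and j_1 [simp]: "j 1 = 1"
  by (auto simp: j_def)

lemma j_nonunit: "int p dvd t \<Longrightarrow> j t = 0"
proof -
  assume "int p dvd t"
  then have "int p dvd t ^ (2 * q)" using q(1) by (simp add: prime_gt_0_nat dvd_power_le dvd_trans[OF _ dvd_power])
  moreover have "\<not> int p dvd 1" using p_gt_2 by simp
  ultimately have "\<not> t ^ (2 * q) \<doteq> 1" using cong_p cong_dvd_iff by blast
  then show ?thesis by (simp add: j_def)
qed

text \<open>The factor \<open>\<Sum>i<2q. t\<^sup>i\<close> of \<open>t\<^bsup>2q\<^esup> - 1\<close> is congruent to \<open>2q\<close> modulo \<open>p\<close>.\<close>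

lemma j_near_1:
  assumes "int p dvd w" "\<not> w \<doteq> 0"
  shows "j (1 + w) = 0"
proof -
  define t where "t = 1 + w"
  have t: "[t = 1] (mod int p)" using assms(1) by (simp add: t_def cong_iff_dvd_diff)
  have "[(\<Sum>i<2*q. t ^ i) = (\<Sum>i<2*q. 1)] (mod int p)"
    by (intro cong_sum) (use cong_pow[OF t] in simp)
  moreover have "\<not> int p dvd (\<Sum>i<2*q. 1)"
  proof
    assume "int p dvd (\<Sum>i<2*q. 1)"
    then have "p dvd 2 * q" by (simp flip: int_dvd_int_iff)
    then have "p dvd 2 \<or> p dvd q" using p(1) by (simp add: prime_dvd_mult_iff)
    then show False using p q p_gt_2 primes_dvd_imp_eq[of p q] by (auto dest: dvd_imp_le)
  qed
  ultimately have "coprime (\<Sum>i<2*q. t ^ i) N"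
    using p_dvd_iff_not_coprime cong_dvd_iff by blast
  moreover have "t ^ (2 * q) - 1 = w * (\<Sum>i<2*q. t ^ i)"
    by (simp add: power_diff_1_eq t_def)
  ultimately have "\<not> N dvd t ^ (2 * q) - 1"
    using assms(2) by (metis cong_0_iff coprime_commute coprime_dvd_mult_left_iff)
  then show ?thesis by (simp add: j_def t_def cong_iff_dvd_diff)
qed

text \<open>A period \<open>d\<close> would force \<open>j\<close> to be 1 on all
  \<open>1 + k * d\<close>. If \<open>p\<close> divides \<open>d\<close>, then
  \<open>j_near_1\<close> contradicts this for \<open>k = 1\<close>; otherwise some
  \<open>1 + k * d\<close> is divisible by \<open>p\<close>, and there \<open>j\<close>
  vanishes.\<close>

lemma j_not_periodic:
  assumes "\<not> d \<doteq> 0"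
  shows "\<exists>t. \<not> j (t + d) \<doteq> j t"
proof (rule ccontr)
  assume "\<not> ?thesis"
  then have per: "j (t + d) \<doteq> j t" for t by blast
  have per': "j (1 + int k * d) \<doteq> 1" for k
  proof (induction k)
    case (Suc k)
    have "1 + int (Suc k) * d = (1 + int k * d) + d" by (simp add: algebra_simps)
    then show ?case using per[of "1 + int k * d"] Suc cong_trans by metis
  qed simp
  have not01: "\<not> 0 \<doteq> 1" using N_gt_1 by (simp add: cong_0_1_int)
  show False
  proof (cases "int p dvd d")
    case True
    then show False using j_near_1[OF True assms] per'[of 1] not01 by simp
  next
    case False
    then have "coprime d (int p)"
      using p(1) prime_imp_coprime[of "int p" d] by (simp add: coprime_commute)
    then obtain x where x: "[d * x = 1] (mod int p)" using cong_solve_coprime_int by blast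
    \<comment> \<open>A nonnegative representative of the negative inverse of \<open>d\<close>
      modulo \<open>p\<close>, since \<open>per'\<close> covers natural multiples only.\<close>
    define k where "k = nat ((- x) mod int p)"
    have "int k = (- x) mod int p" using p_gt_2 by (simp add: k_def)
    then have "[int k = - x] (mod int p)" by (simp add: cong_def)
    then have "[1 + int k * d = 1 + (- x) * d] (mod int p)" by (intro cong_add cong_mult cong_refl)
    moreover have "[1 + (- x) * d = 0] (mod int p)"
      using x by (simp add: cong_iff_dvd_diff dvd_diff_commute mult.commute)
    ultimately have "int p dvd 1 + int k * d" by (metis cong_0_iff cong_trans)
    then show False using per'[of k] j_nonunit not01 by simp
  qed
qed

section \<open>The solution\<close>

lemma N_pos: "N > 0"
  using N_gt_1 by linarith

lemma p_pos [simp]: "0 < p" "p \<noteq> 0"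
  using p_gt_2 by simp_all

lemma mod_N_nonneg [simp]: "0 \<le> a mod N" and mod_N_less [simp]: "a mod N < N"
  using N_pos pos_mod_sign pos_mod_bound by blast+

text \<open>Pairs of residues modulo \<open>N\<close> are encoded as the natural numbers below \<open>N\<^sup>2\<close>.\<close>

definition p1 :: "nat \<Rightarrow> int" where "p1 x = int x div N"

definition p2 :: "nat \<Rightarrow> int" where "p2 x = int x mod N"

definition mk :: "int \<Rightarrow> int \<Rightarrow> nat" where "mk a b = nat (a mod N * N + b mod N)"

definition X :: "nat set" where "X = {..<p ^ (2 * n)}"

lemma int_mk: "int (mk a b) = a mod N * N + b mod N"
  by (simp add: mk_def)

lemma p1_mk [simp]: "p1 (mk a b) = a mod N" and p2_mk [simp]: "p2 (mk a b) = b mod N"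
  using N_gt_1 by (simp_all add: p1_def p2_def int_mk)

lemma mk_in_X [simp]: "mk a b \<in> X"
proof -
  have "a mod N * N + b mod N < (a mod N + 1) * N" using N_gt_1 by (simp add: algebra_simps)
  also have "\<dots> \<le> N * N" using N_pos mod_N_less[of a] by (intro mult_right_mono) linarith+
  finally have "int (mk a b) < int (p ^ (2 * n))"
    by (simp add: int_mk mult_2 power_add)
  then show ?thesis by (simp only: X_def of_nat_less_iff lessThan_iff)
qed

lemma mk_p1_p2: "x \<in> X \<Longrightarrow> mk (p1 x) (p2 x) = x"
proof -
  assume "x \<in> X"
  then have "x < p ^ n * p ^ n" by (simp add: X_def mult_2 power_add)
  then have "int (x div p ^ n) < int (p ^ n)"
    unfolding of_nat_less_iff by (rule less_mult_imp_div_less)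
  then have "int x div N < N" by (simp add: zdiv_int)
  moreover have "int x div N \<ge> 0" using N_pos pos_imp_zdiv_nonneg_iff by simp
  ultimately have "int (mk (p1 x) (p2 x)) = int x" by (simp add: int_mk p1_def p2_def div_mult_mod_eq)
  then show ?thesis by (simp only: of_nat_eq_iff)
qed

lemma X_coords: "x \<in> X \<Longrightarrow> \<exists>a b. x = mk a b"
  using mk_p1_p2 by metis

lemma mk_eq_iff: "mk a b = mk c e \<longleftrightarrow> a \<doteq> c \<and> b \<doteq> e"
  unfolding cong_def by (metis p1_mk p2_mk mk_def)

lemma mkI: "a \<doteq> c \<Longrightarrow> b \<doteq> e \<Longrightarrow> mk a b = mk c e"
  by (simp add: mk_eq_iff)

lemma card_X: "card X = p ^ (2 * n)" and finite_X [simp]: "finite X"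
  by (simp_all add: X_def)

lemmas cong_rules = cong_add cong_diff cong_mult j_cong cong_refl

text \<open>\<open>d\<close> is the cycle set operation and \<open>s x\<close> is the inverse \<open>\<sigma>\<^sub>x\<close> of \<open>d x\<close>.\<close>

definition d :: "nat \<Rightarrow> nat \<Rightarrow> nat" where
  "d x z = mk (\<beta> * p1 z + p2 x) (\<beta> * p2 z + j (p1 z - p1 x))"

definition s :: "nat \<Rightarrow> nat \<Rightarrow> nat" where
  "s x z = mk (\<alpha> * (p1 z - p2 x)) (\<alpha> * (p2 z - j (\<alpha> * (p1 z - p2 x) - p1 x)))"

definition r :: "nat \<times> nat \<Rightarrow> nat \<times> nat" where
  "r = (\<lambda>(x, y). (s x y, d (s x y) x))"

lemma mod_N_cong: "a mod N \<doteq> a"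
  by (simp add: cong_def)

lemma d_mk [simp]: "d (mk a b) (mk c e) = mk (\<beta> * c + b) (\<beta> * e + j (c - a))"
  unfolding d_def p1_mk p2_mk by (intro mkI cong_rules mod_N_cong)

lemma s_mk [simp]:
  "s (mk a b) (mk c e) = mk (\<alpha> * (c - b)) (\<alpha> * (e - j (\<alpha> * (c - b) - a)))"
  unfolding s_def p1_mk p2_mk by (intro mkI cong_rules mod_N_cong)

lemma d_in_X [simp]: "d x z \<in> X" and s_in_X [simp]: "s x z \<in> X"
  by (simp_all add: d_def s_def)

lemma s_d:
  assumes "x \<in> X" "y \<in> X"
  shows "s x (d x y) = y"
proof -
  obtain a b c e where xy: "x = mk a b" "y = mk c e" using assms[THEN X_coords] by blast
  have "\<beta> * e + j (c - a) - j (\<alpha> * (\<beta> * c) - a) \<doteq> \<beta> * e + j (c - a) - j (c - a)"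
    by (intro cong_rules \<alpha>\<beta>_cancel)
  then have "\<alpha> * (\<beta> * e + j (c - a) - j (\<alpha> * (\<beta> * c) - a)) \<doteq> \<alpha> * (\<beta> * e)"
    by (intro cong_mult cong_refl) simp
  then have "\<alpha> * (\<beta> * e + j (c - a) - j (\<alpha> * (\<beta> * c) - a)) \<doteq> e"
    using \<alpha>\<beta>_cancel(1) cong_trans by blast
  then show ?thesis by (simp add: xy mk_eq_iff)
qed

lemma d_s:
  assumes "x \<in> X" "y \<in> X"
  shows "d x (s x y) = y"
proof -
  obtain a b c e where xy: "x = mk a b" "y = mk c e" using assms[THEN X_coords] by blast
  have "\<beta> * (\<alpha> * (c - b)) + b \<doteq> c - b + b"
    by (intro cong_rules \<alpha>\<beta>_cancel)
  moreover have "\<beta> * (\<alpha> * (e - j (\<alpha> * (c - b) - a))) + j (\<alpha> * (c - b) - a) \<doteq>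
      e - j (\<alpha> * (c - b) - a) + j (\<alpha> * (c - b) - a)"
    by (intro cong_rules \<alpha>\<beta>_cancel)
  ultimately show ?thesis by (simp add: xy mk_eq_iff)
qed

text \<open>In the cycle identity the first coordinates agree because \<open>j\<close> is even. The
  second ones agree because homogeneity turns both into \<beta> times a sum of
  \<open>j (g - a)\<close> and \<open>j (g - c)\<close>. The square map is triangular, as
  \<open>j 0 = 0\<close>, hence injective.\<close>

lemma ybe_r: "ybe_solution X r"
  unfolding r_def
proof (rule ybe_solution_of_cycle_set)
  show "X \<noteq> {}" using mk_in_X by blast
  show "d (d x y) (d x z) = d (d y x) (d y z)" if X: "x \<in> X" "y \<in> X" "z \<in> X" for x y z
  proof -
    obtain a b c e g h where xyz: "x = mk a b" "y = mk c e" "z = mk g h"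
      using X[THEN X_coords] by blast
    have j: "j (c - a) = j (a - c)" using j_minus[of "a - c"] by simp
    have j\<beta>: "j (\<beta> * u - \<beta> * v) \<doteq> \<beta> * j (u - v)" for u v
      using j_\<beta>[of "u - v"] by (simp add: right_diff_distrib)
    have "\<beta> * (\<beta> * h + j (g - a)) + j (\<beta> * g - \<beta> * c) \<doteq> \<beta> * (\<beta> * h + j (g - a)) + \<beta> * j (g - c)"
      by (intro cong_rules j\<beta>)
    moreover have "\<beta> * (\<beta> * h + j (g - c)) + j (\<beta> * g - \<beta> * a) \<doteq> \<beta> * (\<beta> * h + j (g - c)) + \<beta> * j (g - a)"
      by (intro cong_rules j\<beta>)
    moreover have "\<beta> * (\<beta> * h + j (g - a)) + \<beta> * j (g - c) = \<beta> * (\<beta> * h + j (g - c)) + \<beta> * j (g - a)"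
      by (simp add: algebra_simps)
    ultimately have "\<beta> * (\<beta> * h + j (g - a)) + j (\<beta> * g - \<beta> * c) \<doteq>
        \<beta> * (\<beta> * h + j (g - c)) + j (\<beta> * g - \<beta> * a)"
      by (simp only: cong_def)
    then show ?thesis by (simp add: xyz mk_eq_iff j algebra_simps)
  qed
  show "inj_on (\<lambda>x. d x x) X"
  proof (rule inj_onI)
    fix x y assume xy: "x \<in> X" "y \<in> X" "d x x = d y y"
    obtain a b c e where xy': "x = mk a b" "y = mk c e" using xy(1,2)[THEN X_coords] by blast
    have \<beta>: "u \<doteq> v" if "\<beta> * u \<doteq> \<beta> * v" for u v
      using cong_mult[OF cong_refl[of \<alpha>] that] \<alpha>\<beta>_cancel(1) by (meson cong_sym cong_trans)
    from xy(3) have "\<beta> * a + b \<doteq> \<beta> * c + e" "\<beta> * b \<doteq> \<beta> * e"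
      by (simp_all add: xy' mk_eq_iff)
    moreover from this \<beta> have "b \<doteq> e" by blast
    ultimately have "\<beta> * a + b - b \<doteq> \<beta> * c + e - e" by (intro cong_diff)
    with \<beta> \<open>b \<doteq> e\<close> show "x = y" by (simp add: xy' mk_eq_iff)
  qed
qed (simp_all add: s_d d_s)

lemma lmap_r: "lmap r x y = s x y"
  by (simp add: lmap_def r_def)

abbreviation G :: "(nat \<Rightarrow> nat) monoid" where "G \<equiv> perm_group X r"

sublocale act: group_action G X "\<lambda>g. g"
  by (rule perm_group_action[OF ybe_r])

section \<open>Orbits of the permutation group and indecomposability\<close>

definition reach :: "nat \<Rightarrow> nat \<Rightarrow> bool" where
  "reach x y \<longleftrightarrow> (\<exists>g \<in> carrier G. g x = y)"

lemma reach_trans: "reach x y \<Longrightarrow> reach y z \<Longrightarrow> x \<in> X \<Longrightarrow> reach x z"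
  unfolding reach_def using act.composition_rule act.group_hom group_hom.axioms(1)
  by (metis group.is_monoid monoid.m_closed)

lemma reach_sym: "reach x y \<Longrightarrow> x \<in> X \<Longrightarrow> reach y x"
  unfolding reach_def using act.orbit_sym_aux act.group_hom group_hom.axioms(1) group.inv_closed
  by metis

lemma gen_in_G: "restrict (lmap r x) X \<in> carrier G" if "x \<in> X"
  using that by (auto simp: perm_group_def intro: generate.incl)

lemma reach_s: "x \<in> X \<Longrightarrow> y \<in> X \<Longrightarrow> reach y (s x y)"
  unfolding reach_def by (rule bexI[OF _ gen_in_G[of x]]) (simp_all add: lmap_r)

lemma reach_d: "x \<in> X \<Longrightarrow> y \<in> X \<Longrightarrow> reach y (d x y)"
  using reach_sym[OF reach_s[of x "d x y"]] by (simp add: s_d)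

text \<open>\<open>\<sigma>\<^bsub>(a',0)\<^esub> \<circ> \<sigma>\<^bsub>(a,b)\<^esub>\<^sup>-\<^sup>1\<close> in coordinates.\<close>

lemma s_d_mk:
  "s (mk a' 0) (d (mk a (\<beta> * u)) (mk c e)) =
   mk (c + u) (e + \<alpha> * (j (c - a) - j (c + u - a')))"
proof -
  have u: "\<alpha> * (\<beta> * c + \<beta> * u) \<doteq> c + u"
    using \<alpha>\<beta>_cancel(1)[of "c + u"] by (simp add: distrib_left)
  have "\<alpha> * (\<beta> * e + j (c - a) - j (\<alpha> * (\<beta> * c + \<beta> * u) - a')) \<doteq>
      \<alpha> * (\<beta> * e + j (c - a) - j (c + u - a'))"
    by (intro cong_rules u)
  also have "\<alpha> * (\<beta> * e + j (c - a) - j (c + u - a')) =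
      \<alpha> * (\<beta> * e) + \<alpha> * (j (c - a) - j (c + u - a'))" by (simp add: algebra_simps)
  also have "\<alpha> * (\<beta> * e) + \<alpha> * (j (c - a) - j (c + u - a')) \<doteq>
      e + \<alpha> * (j (c - a) - j (c + u - a'))" by (intro cong_rules \<alpha>\<beta>_cancel)
  finally show ?thesis using u by (simp add: mk_eq_iff)
qed

text \<open>Since \<alpha> is a unit, repeated steps of size \<alpha> reach every second
  coordinate.\<close>

lemma mk_mult_\<alpha>: "\<exists>k :: nat. mk c (e + int k * \<alpha>) = mk c e'"
proof -
  define k where "k = nat (\<beta> * (e' - e) mod N)"
  have "int k = \<beta> * (e' - e) mod N" by (simp add: k_def)
  then have "e + int k * \<alpha> \<doteq> e + \<beta> * (e' - e) * \<alpha>"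
    by (intro cong_rules) (simp add: mod_N_cong)
  also have "e + \<beta> * (e' - e) * \<alpha> = e + \<alpha> * (\<beta> * (e' - e))" by simp
  also have "e + \<alpha> * (\<beta> * (e' - e)) \<doteq> e + (e' - e)" by (intro cong_rules \<alpha>\<beta>_cancel)
  finally show ?thesis by (auto simp: mk_eq_iff)
qed

lemma indecomposable_r: "indecomposable_solution X r"
  unfolding indecomposable_solution_iff
proof (intro conjI ybe_r ballI)
  fix x y assume xyX: "x \<in> X" "y \<in> X"
  obtain a b c e where xy: "x = mk a b" "y = mk c e" using xyX[THEN X_coords] by blast
  have step: "reach (mk u v) (mk (u + t) (v + \<alpha> * (j (u - f) - j (u + t - f'))))" for u v t f f'
    unfolding s_d_mk[symmetric] by (intro reach_trans[OF reach_d reach_s]) (simp_all del: d_mk)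
  have iter: "reach (mk u v) (mk u (v + int k * \<alpha>))" for u v k
  proof (induction k)
    case 0
    show ?case using step[of u v 0 0 0] by simp
  next
    case (Suc k)
    show ?case
      \<comment> \<open>The two arguments of \<open>j\<close> are 1 and 0 here, so the first
        coordinate is kept and the second grows by exactly \<alpha>.\<close>
      using reach_trans[OF Suc step[of u _ 0 "u - 1" u]] by (simp add: algebra_simps)
  qed
  obtain v where v: "reach x (mk c v)"
    using step[of a b "c - a"] by (auto simp: xy)
  obtain k where "mk c (v + int k * \<alpha>) = y" using mk_mult_\<alpha> xy by blast
  with reach_trans[OF v iter[of c v k]] show "\<exists>g \<in> carrier G. g x = y"
    using xyX by (simp add: reach_def)
qed

section \<open>Simplicity\<close>

text \<open>The fibres of \<open>f\<close> are the classes of a congruence. Simplicity follows by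
  letting \<open>f\<close> be an epimorphism.\<close>

lemma congruence_trivial:
  fixes f :: "nat \<Rightarrow> 'b"
  assumes fd: "\<And>x x' z z'. \<lbrakk>x \<in> X; x' \<in> X; z \<in> X; z' \<in> X; f x = f x'; f z = f z'\<rbrakk>
      \<Longrightarrow> f (d x z) = f (d x' z')"
    and fs: "\<And>x x' z z'. \<lbrakk>x \<in> X; x' \<in> X; z \<in> X; z' \<in> X; f x = f x'; f z = f z'\<rbrakk>
      \<Longrightarrow> f (s x z) = f (s x' z')"
    and ninj: "\<not> inj_on f X"
    and xy: "x \<in> X" "y \<in> X"
  shows "f x = f y"
proof -
  define F where "F a b = f (mk a b)" for a b
  have Fcong: "F a b = F a' b'" if "a \<doteq> a'" "b \<doteq> b'" for a b a' b'
    using mkI[OF that] by (simp add: F_def)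
  \<comment> \<open>Identified points stay identified under the maps of \<open>s_d_mk\<close>. The
    parameters \<open>a\<close>, \<open>a'\<close> and \<open>u\<close> are free.\<close>
  have T: "F (c + u) (e + \<alpha> * (j (c - a) - j (c + u - a'))) =
      F (c' + u) (e' + \<alpha> * (j (c' - a) - j (c' + u - a')))"
    if "F c e = F c' e'" for c e c' e' u a a'
    unfolding F_def s_d_mk[symmetric]
    using that by (intro fs fd) (simp_all add: F_def del: d_mk s_mk)
  have A: "F u v = F (u + (b' - b)) (v + (j (\<alpha> * (u - b) - a') - j (\<alpha> * (u - b) - a)))"
    if "F a b = F a' b'" for a b a' b' u v
  proof -
    \<comment> \<open>The point \<open>(c, e)\<close> is chosen so that \<open>(a, b)\<close> sends
      it to \<open>(u, v)\<close>. Acting on it with the identified point \<open>(a', b')\<close>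
      then gives the right-hand side.\<close>
    define c where "c = \<alpha> * (u - b)"
    define e where "e = \<alpha> * (v - j (c - a))"
    have c: "\<beta> * c \<doteq> u - b" and e: "\<beta> * e \<doteq> v - j (c - a)"
      by (simp_all add: c_def e_def)
    have "F (\<beta> * c + b) (\<beta> * e + j (c - a)) = F (\<beta> * c + b') (\<beta> * e + j (c - a'))"
      using fd[of "mk a b" "mk a' b'" "mk c e" "mk c e"] that by (simp add: F_def)
    moreover have "F (\<beta> * c + b) (\<beta> * e + j (c - a)) = F (u - b + b) (v - j (c - a) + j (c - a))"
      by (intro Fcong cong_add c e cong_refl)
    moreover have "F (\<beta> * c + b') (\<beta> * e + j (c - a')) = F (u - b + b') (v - j (c - a) + j (c - a'))"
      by (intro Fcong cong_add c e cong_refl)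
    ultimately show ?thesis by (simp add: c_def algebra_simps)
  qed
  define V where "V w \<longleftrightarrow> (\<forall>u v. F u v = F u (v + w))" for w
  have VD: "F u (v + w) = F u v" if "V w" for u v w
    using that by (simp add: V_def)
  \<comment> \<open>One coincidence suffices: \<open>T\<close> with \<open>j 1 - j 0\<close> moves
    both points by \<alpha> along the fibre over \<open>u\<close>, and \<open>T\<close> with shift
    \<open>u' - u\<close> carries them to the fibre over \<open>u'\<close>.\<close>
  have VI: "V w" if uv: "F u v = F u (v + w)" for u v w
    unfolding V_def
  proof (intro allI)
    fix u' v'
    have iter: "F u (v + int k * \<alpha>) = F u (v + w + int k * \<alpha>)" for k
    proof (induction k)
      case (Suc k)
      show ?case using T[OF Suc, of 0 "u - 1" u] by (simp add: algebra_simps)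
    qed (simp add: uv)
    define \<kappa> where "\<kappa> = \<alpha> * (j u - j u')"
    obtain k where k: "v + \<kappa> + int k * \<alpha> \<doteq> v'" using mk_mult_\<alpha> mk_eq_iff by blast
    have "F u' (v + \<kappa> + int k * \<alpha>) = F u' (v + \<kappa> + int k * \<alpha> + w)"
      using T[OF iter[of k], of "u' - u" 0 0] by (simp add: \<kappa>_def algebra_simps)
    moreover have "F u' (v + \<kappa> + int k * \<alpha>) = F u' v'"
      "F u' (v + \<kappa> + int k * \<alpha> + w) = F u' (v' + w)"
      by (intro Fcong cong_add k cong_refl)+
    ultimately show "F u' v' = F u' (v' + w)" by simp
  qed
  \<comment> \<open>Acting with the identified points \<open>(0, 0)\<close> and
    \<open>(0, w)\<close> turns a period of the second coordinate into one of the first.\<close>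
  have V_shift: "F u v = F (u + w) v" if "V w" for u v w
    using A[of 0 0 0 w u v] VD[OF that, of 0 0] by simp
  have V_j: "V (j (t + w) - j t)" if w: "V w" for w t
  proof -
    have "F 0 0 = F (- w) 0" using V_shift[OF w, of "- w" 0] by simp
    from A[OF this, of "\<beta> * t" 0]
    have "F (\<beta> * t) 0 = F (\<beta> * t) (j (\<alpha> * (\<beta> * t) + w) - j (\<alpha> * (\<beta> * t)))" by simp
    also have "\<dots> = F (\<beta> * t) (0 + (j (t + w) - j t))"
      by (simp, intro Fcong cong_rules \<alpha>\<beta>_cancel)
    finally show ?thesis by (rule VI)
  qed
  have V_mult: "V (int k * w)" if "V w" for k w
  proof (induction k)
    case (Suc k)
    then show ?case using that by (simp add: V_def distrib_right add.assoc[symmetric] add.commute[of w])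
  qed (simp add: V_def)
  have V_unit: "V w'" if w: "V w" "coprime w N" for w w'
  proof -
    obtain z where z: "w * z \<doteq> 1" using cong_solve_coprime_int[OF w(2)] by blast
    define k where "k = nat (z * w' mod N)"
    have "int k * w \<doteq> z * w' * w" unfolding k_def by (intro cong_mult) (simp_all add: mod_N_cong)
    moreover have "w * z * w' \<doteq> 1 * w'" by (intro cong_mult z cong_refl)
    ultimately have "int k * w \<doteq> w'" by (simp add: mult_ac cong_def)
    then show "V w'" using V_mult[OF w(1), of k] Fcong[OF cong_refl cong_add[OF cong_refl]]
      unfolding V_def by metis
  qed
  obtain a b a' b' where ab: "F a b = F a' b'" "mk a b \<noteq> mk a' b'"
    using ninj X_coords unfolding inj_on_def F_def by metis
  have "\<exists>w. V w \<and> \<not> w \<doteq> 0"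
  proof (cases "b \<doteq> b'")
    case True
    with ab(2) have "\<not> a - a' \<doteq> 0" by (simp add: mk_eq_iff cong_diff_iff_cong_0)
    then obtain t where t: "\<not> j (t + (a - a')) \<doteq> j t" using j_not_periodic by blast
    define u where "u = \<beta> * (t + a) + b"
    have u: "\<alpha> * (u - b) \<doteq> t + a" by (simp add: u_def)
    have "F u 0 = F (u + (b' - b)) (0 + (j (\<alpha> * (u - b) - a') - j (\<alpha> * (u - b) - a)))"
      by (rule A[OF ab(1)])
    also have "\<dots> = F (u + (b' - b')) (0 + (j (t + a - a') - j (t + a - a)))"
      by (intro Fcong cong_rules True u)
    finally have "V (j (t + (a - a')) - j t)" by (intro VI[of u 0]) (simp add: algebra_simps)
    with t show ?thesis by (metis cong_diff_iff_cong_0)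
  next
    case False
    \<comment> \<open>The fibres over 0 and \<delta> are matched by the constant shift
      \<open>k\<close>. The parameters \<open>- t\<close> and \<open>t + \<delta>\<close> are mirror
      images about these two fibres, so by evenness \<open>T\<close> moves them by opposite amounts.
      Comparison with the matching leaves twice that amount as a period.\<close>
    define \<delta> where "\<delta> = b' - b"
    have "\<not> \<delta> \<doteq> 0" unfolding \<delta>_def cong_diff_iff_cong_0 using False cong_sym by blast
    then obtain t where t: "\<not> j (t + \<delta>) \<doteq> j t" using j_not_periodic by blast
    define k where "k = j (\<alpha> * (0 - b) - a') - j (\<alpha> * (0 - b) - a)"
    have A': "F 0 v = F \<delta> (v + k)" for v
      using A[OF ab(1), of 0 v] by (simp add: \<delta>_def k_def)
    have tt: "j (- \<delta> - t) = j (\<delta> + t)"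
      using j_minus[of "\<delta> + t"] by simp
    have "F 0 (\<alpha> * (j t - j (t + \<delta>))) = F \<delta> (k + \<alpha> * (j (t + \<delta>) - j t))"
      using T[OF A'[of 0], of 0 "- t" "t + \<delta>"] by (simp add: tt add.commute)
    moreover have "F 0 (\<alpha> * (j t - j (t + \<delta>))) = F \<delta> (\<alpha> * (j t - j (t + \<delta>)) + k)"
      by (rule A')
    ultimately have "F \<delta> (\<alpha> * (j t - j (t + \<delta>)) + k) =
        F \<delta> (\<alpha> * (j t - j (t + \<delta>)) + k + 2 * (\<alpha> * (j (t + \<delta>) - j t)))"
      by (simp add: algebra_simps)
    then have "V (2 * (\<alpha> * (j (t + \<delta>) - j t)))" by (rule VI)
    moreover have "\<not> \<alpha> * (j (t + \<delta>) - j t) \<doteq> 0"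
    proof
      assume "\<alpha> * (j (t + \<delta>) - j t) \<doteq> 0"
      then have "\<beta> * (\<alpha> * (j (t + \<delta>) - j t)) \<doteq> \<beta> * 0" by (intro cong_mult cong_refl)
      then have "j (t + \<delta>) - j t \<doteq> 0" using \<alpha>\<beta>_cancel(2)[of "j (t + \<delta>) - j t"] by (simp add: cong_def)
      then show False using t cong_diff_iff_cong_0 by blast
    qed
    ultimately show ?thesis using two_unit by blast
  qed
  then obtain w where w: "V w" "\<not> w \<doteq> 0" by blast
  have V_all: "V w'" for w'
  proof (cases "coprime w N")
    case True
    then show ?thesis using V_unit w(1) by blast
  next
    case False
    then have "j (1 + w) = 0" using j_near_1 w(2) p_dvd_iff_not_coprime by blast
    then have "V (- 1)" using V_j[OF w(1), of 1] by simp
    then show ?thesis by (rule V_unit) simp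
  qed
  have "F a b = F 0 0" for a b
    using V_shift[OF V_all, of 0 b a] VD[OF V_all, of 0 0 b] by simp
  then show ?thesis using xy[THEN X_coords] unfolding F_def by metis
qed

lemma simple_r: "simple_solution X r"
  unfolding simple_solution_def
proof (intro conjI allI impI)
  show "ybe_solution X r" by (rule ybe_r)
  show "infinite X \<or> 1 < card X"
    using one_less_power[of p "2 * n"] p_gt_2 n by (simp add: card_X)
  fix Y :: "nat set" and s' f
  assume "ybe_solution Y s' \<and> solution_epi X r Y s' f"
  then have Y: "ybe_solution Y s'" and hom: "solution_hom X r Y s' f" and im: "f ` X = Y"
    by (auto simp: solution_epi_def)
  have fs: "f (s x z) = lmap s' (f x) (f z)" if "x \<in> X" "z \<in> X" for x z
    using hom that by (simp add: solution_hom_def lmap_r)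
  have inj: "inj_on (lmap s' (f x)) Y" if "x \<in> X" for x
    using Y im that by (auto simp: ybe_solution_def bij_betw_def)
  \<comment> \<open>Compatibility with \<open>d\<close> follows from that with \<open>s\<close> by
    cancelling the injective \<open>lmap s' (f x)\<close>.\<close>
  have fd: "f (d x z) = f (d x' z')"
    if x: "x \<in> X" "x' \<in> X" "z \<in> X" "z' \<in> X" "f x = f x'" "f z = f z'" for x x' z z'
  proof (rule inj_onD[OF inj[OF x(1)]])
    show "lmap s' (f x) (f (d x z)) = lmap s' (f x) (f (d x' z'))"
      using fs[of x "d x z"] fs[of x' "d x' z'"] x by (simp add: s_d)
  qed (use im in auto)
  show "solution_iso X r Y s' f \<or> card Y = 1"
  proof (cases "inj_on f X")
    case True
    then show ?thesis using hom im by (simp add: solution_iso_def bij_betw_def)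
  next
    case False
    have "f x = f (mk 0 0)" if "x \<in> X" for x
      by (rule congruence_trivial[OF fd _ False that mk_in_X]) (simp_all add: fs)
    then have "f ` X = (\<lambda>_. f (mk 0 0)) ` X" by (intro image_cong refl)
    also have "\<dots> = {f (mk 0 0)}" using mk_in_X by blast
    finally show ?thesis using im by simp
  qed
qed

section \<open>The order of the permutation group\<close>

text \<open>The function \<open>f\<close> is evaluated only at the reduced representative
  \<open>p1 x\<close>. This is the source of the \<open>mod N\<close> in the rules for evaluation
  and composition.\<close>

definition aff :: "nat \<Rightarrow> int \<Rightarrow> (int \<Rightarrow> int) \<Rightarrow> nat \<Rightarrow> nat" where
  "aff i u f = (\<lambda>x \<in> X. mk (\<alpha> ^ i * p1 x + u) (\<alpha> ^ i * p2 x + f (p1 x)))"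

definition affs :: "(nat \<Rightarrow> nat) set" where
  "affs = {aff i u f | i u f. True}"

lemma aff_in_affs [simp]: "aff i u f \<in> affs"
  unfolding affs_def by blast

lemma affsE:
  assumes "g \<in> affs"
  obtains i u f where "g = aff i u f"
  using assms unfolding affs_def by blast

lemma aff_mk: "aff i u f (mk a b) = mk (\<alpha> ^ i * a + u) (\<alpha> ^ i * b + f (a mod N))"
  unfolding aff_def by (simp, intro mkI cong_rules mod_N_cong)

lemma aff_eqI:
  assumes "\<And>a b. g (mk a b) = aff i u f (mk a b)" "g \<in> extensional X"
  shows "g = aff i u f"
  by (rule extensionalityI[OF assms(2)]) (auto simp: aff_def assms(1)[unfolded aff_def] dest!: X_coords)

lemma compose_aff:
  "compose X (aff i u f) (aff i' u' f') =
   aff (i + i') (\<alpha> ^ i * u' + u) (\<lambda>c. \<alpha> ^ i * f' c + f ((\<alpha> ^ i' * c + u') mod N))"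
proof (rule aff_eqI)
  fix a b
  have "\<alpha> ^ i' * a + u' \<doteq> \<alpha> ^ i' * (a mod N) + u'"
    by (intro cong_rules cong_sym[OF mod_N_cong])
  then have "(\<alpha> ^ i' * a + u') mod N = (\<alpha> ^ i' * (a mod N) + u') mod N"
    by (simp only: cong_def)
  then show "compose X (aff i u f) (aff i' u' f') (mk a b) =
    aff (i + i') (\<alpha> ^ i * u' + u) (\<lambda>c. \<alpha> ^ i * f' c + f ((\<alpha> ^ i' * c + u') mod N)) (mk a b)"
    by (simp add: compose_def aff_mk power_add algebra_simps)
qed (simp add: compose_def)

lemma aff_0: "aff 0 0 (\<lambda>_. 0) = (\<lambda>x \<in> X. x)"
  by (auto simp: aff_def mk_p1_p2)

lemma aff_left_inverse:
  "\<exists>i' u' f'. compose X (aff i' u' f') (aff i u f) = (\<lambda>x \<in> X. x)"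
proof -
  \<comment> \<open>\<open>\<alpha> ^ i'\<close> inverts \<open>\<alpha> ^ i\<close>, since the
    exponents add up to a multiple of \<open>q\<close>. The function \<open>f'\<close> first
    recovers the original first coordinate from \<open>y\<close> and then cancels \<open>f\<close>
    there.\<close>
  define i' where "i' = i * (q - 1)"
  define f' where "f' y = - (\<alpha> ^ i' * f ((\<alpha> ^ i' * (y - u)) mod N))" for y
  have ii': "i' + i = q * i" using q(1) prime_gt_0_nat[of q]
    by (cases q) (simp_all add: i'_def)
  then have 1: "\<alpha> ^ (i' + i) * a \<doteq> a" for a
    using cong_mult[OF \<alpha>_pow_iff[THEN iffD2, of "i' + i"] cong_refl[of a]] by simp
  have f: "f ((\<alpha> ^ i' * ((\<alpha> ^ i * (a mod N) + u) mod N - u)) mod N) = f (a mod N)" for a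
  proof -
    have "\<alpha> ^ i' * ((\<alpha> ^ i * (a mod N) + u) mod N - u) \<doteq> \<alpha> ^ i' * ((\<alpha> ^ i * a + u) - u)"
      by (intro cong_rules cong_trans[OF mod_N_cong] mod_N_cong)
    also have "\<alpha> ^ i' * ((\<alpha> ^ i * a + u) - u) = \<alpha> ^ (i' + i) * a" by (simp add: power_add)
    finally have "\<alpha> ^ i' * ((\<alpha> ^ i * (a mod N) + u) mod N - u) \<doteq> a" by (rule cong_trans[OF _ 1])
    then show ?thesis by (simp only: cong_def)
  qed
  have "compose X (aff i' (- (\<alpha> ^ i' * u)) f') (aff i u f) = aff 0 0 (\<lambda>_. 0)"
    unfolding compose_aff
  proof (rule aff_eqI)
    show "aff (i' + i) (\<alpha> ^ i' * u + - (\<alpha> ^ i' * u)) (\<lambda>c. \<alpha> ^ i' * f c + f' ((\<alpha> ^ i * c + u) mod N)) (mk a b)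
        = aff 0 0 (\<lambda>_. 0) (mk a b)" for a b
      using 1 by (simp add: aff_mk f'_def f mk_eq_iff)
  qed (simp add: aff_def)
  then show ?thesis unfolding aff_0 by blast
qed

lemma aff_in_X: "x \<in> X \<Longrightarrow> aff i u f x \<in> X"
  by (simp add: aff_def)

lemma aff_Bij: "aff i u f \<in> Bij X"
proof -
  obtain i' u' f' where "compose X (aff i' u' f') (aff i u f) = (\<lambda>x \<in> X. x)"
    using aff_left_inverse by blast
  then have "aff i' u' f' (aff i u f x) = x" if "x \<in> X" for x
    using that by (metis compose_eq restrict_apply')
  then have "inj_on (aff i u f) X" by (rule inj_on_inverseI)
  moreover have "aff i u f ` X \<subseteq> X" by (auto simp: aff_in_X)
  ultimately have "bij_betw (aff i u f) X X"
    by (simp add: bij_betw_def endo_inj_surj)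
  then show ?thesis by (simp add: Bij_def aff_def)
qed

lemma subgroup_affs: "subgroup affs (BijGroup X)"
proof -
  interpret B: group "BijGroup X" by (rule group_BijGroup)
  show ?thesis
  proof
    show "affs \<subseteq> carrier (BijGroup X)" by (auto elim!: affsE simp: BijGroup_def aff_Bij)
    show "g \<otimes>\<^bsub>BijGroup X\<^esub> h \<in> affs" if "g \<in> affs" "h \<in> affs" for g h
      using that by (auto elim!: affsE simp: BijGroup_mult aff_Bij compose_aff)
    show "\<one>\<^bsub>BijGroup X\<^esub> \<in> affs" unfolding BijGroup_one aff_0[symmetric] by simp
    show "inv\<^bsub>BijGroup X\<^esub> g \<in> affs" if g: "g \<in> affs" for g
    proof -
      obtain i u f where g: "g = aff i u f" using g by (rule affsE)
      obtain i' u' f' where "compose X (aff i' u' f') (aff i u f) = (\<lambda>x \<in> X. x)"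
        using aff_left_inverse by blast
      then have "aff i' u' f' \<otimes>\<^bsub>BijGroup X\<^esub> g = \<one>\<^bsub>BijGroup X\<^esub>"
        by (simp add: g BijGroup_mult BijGroup_one aff_Bij)
      then have "inv\<^bsub>BijGroup X\<^esub> g = aff i' u' f'"
        by (rule B.inv_equality) (simp_all add: g BijGroup_def aff_Bij)
      then show ?thesis by simp
    qed
  qed
qed

lemma aff_eqD:
  assumes "aff i u f = aff i' u' f'"
  shows "\<alpha> ^ i \<doteq> \<alpha> ^ i'" "u \<doteq> u'" "f (a mod N) \<doteq> f' (a mod N)"
proof -
  have eq: "mk (\<alpha> ^ i * a + u) (\<alpha> ^ i * b + f (a mod N)) = mk (\<alpha> ^ i' * a + u') (\<alpha> ^ i' * b + f' (a mod N))" for a b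
    using assms aff_mk by metis
  show "u \<doteq> u'" using eq[of 0 0] by (simp add: mk_eq_iff)
  show f: "f (a mod N) \<doteq> f' (a mod N)" for a using eq[of a 0] by (simp add: mk_eq_iff)
  have "\<alpha> ^ i + f (0 mod N) \<doteq> \<alpha> ^ i' + f' (0 mod N)" using eq[of 0 1] by (simp add: mk_eq_iff)
  from cong_diff[OF this f[of 0]] show "\<alpha> ^ i \<doteq> \<alpha> ^ i'" by simp
qed

lemma \<alpha>_pow_inj:
  assumes "\<alpha> ^ i \<doteq> \<alpha> ^ k" "i < q" "k < q"
  shows "i = k"
proof -
  have *: "i = k" if "\<alpha> ^ i \<doteq> \<alpha> ^ k" "i \<le> k" "k < q" for i k
  proof -
    have "\<alpha> ^ i * \<beta> ^ i \<doteq> \<alpha> ^ k * \<beta> ^ i" using that by (intro cong_mult cong_refl)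
    moreover have "\<alpha> ^ k * \<beta> ^ i = \<alpha> ^ (k - i) * (\<alpha> * \<beta>) ^ i"
      using that by (simp add: power_mult_distrib power_add[symmetric] mult.assoc[symmetric])
    moreover have "\<alpha> ^ i * \<beta> ^ i = (\<alpha> * \<beta>) ^ i" by (simp add: power_mult_distrib)
    moreover have "(\<alpha> * \<beta>) ^ i \<doteq> 1" using cong_pow[OF \<alpha>\<beta>, of i] by simp
    moreover from this have "\<alpha> ^ (k - i) * (\<alpha> * \<beta>) ^ i \<doteq> \<alpha> ^ (k - i) * 1"
      by (intro cong_mult cong_refl)
    ultimately have "\<alpha> ^ (k - i) \<doteq> 1" by (simp add: cong_def)
    then have "q dvd k - i" by (simp add: \<alpha>_pow_iff)
    then show ?thesis using that by (auto dest: dvd_imp_le)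
  qed
  show ?thesis using *[of i k] *[of k i] assms cong_sym by (cases "i \<le> k") auto
qed

text \<open>Each map has a unique normal form with \<open>i\<close> below \<open>q\<close>,
  \<open>u\<close> reduced, and \<open>f\<close> an extensional function between reduced residues.
  This gives \<open>q\<close> times \<open>N\<close> times \<open>N ^ N\<close> choices.\<close>

lemma card_affs: "card affs = q * p ^ (n + n * p ^ n)"
proof -
  define P where "P = {..<q} \<times> {0..<N} \<times> ({0..<N} \<rightarrow>\<^sub>E {0..<N})"
  define E where "E = (\<lambda>(i, u, f). aff i u f)"
  have N_nat: "nat N = p ^ n" by (metis nat_int of_nat_power)
  have "inj_on E P"
  proof (rule inj_onI)
    fix t t' assume t: "t \<in> P" "t' \<in> P" "E t = E t'"
    obtain i u f i' u' f' where tt: "t = (i, u, f)" "t' = (i', u', f')" by (metis prod_cases3)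
    have eq: "aff i u f = aff i' u' f'" using t by (simp add: tt E_def)
    have "i = i'" using \<alpha>_pow_inj[OF aff_eqD(1)[OF eq]] t by (simp add: tt P_def)
    moreover have "u = u'" using aff_eqD(2)[OF eq] t by (simp add: tt P_def cong_def)
    moreover have "f = f'"
    proof (rule PiE_ext)
      show f: "f \<in> {0..<N} \<rightarrow>\<^sub>E {0..<N}" and f': "f' \<in> {0..<N} \<rightarrow>\<^sub>E {0..<N}"
        using t by (simp_all add: tt P_def)
      show "f a = f' a" if a: "a \<in> {0..<N}" for a
      proof -
        have "f a \<doteq> f' a" using aff_eqD(3)[OF eq, of a] a by simp
        moreover have "f a mod N = f a" "f' a mod N = f' a"
          using PiE_mem[OF f a] PiE_mem[OF f' a] by simp_all
        ultimately show ?thesis by (simp only: cong_def)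
      qed
    qed
    ultimately show "t = t'" by (simp add: tt)
  qed
  moreover have "E ` P = affs"
  proof
    show "E ` P \<subseteq> affs" by (auto simp: E_def)
    show "affs \<subseteq> E ` P"
    proof
      fix g assume "g \<in> affs"
      then obtain i u f where g: "g = aff i u f" by (rule affsE)
      define f' where "f' = (\<lambda>c \<in> {0..<N}. f c mod N)"
      have "\<alpha> ^ (q * (i div q)) * \<alpha> ^ (i mod q) \<doteq> 1 * \<alpha> ^ (i mod q)"
        by (intro cong_mult cong_refl) (simp add: \<alpha>_pow_iff)
      then have \<alpha>: "\<alpha> ^ i \<doteq> \<alpha> ^ (i mod q)" by (simp flip: power_add)
      have "g = aff (i mod q) (u mod N) f'"
      proof (rule aff_eqI)
        show "g (mk a b) = aff (i mod q) (u mod N) f' (mk a b)" for a b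
          unfolding g aff_mk
          by (intro mkI cong_add cong_mult \<alpha> cong_refl) (simp_all add: f'_def cong_def)
      qed (simp add: g aff_def)
      moreover have "(i mod q, u mod N, f') \<in> P"
        using q(1) by (auto simp: P_def f'_def prime_gt_0_nat)
      ultimately show "g \<in> E ` P" by (force simp: E_def)
    qed
  qed
  ultimately have "card affs = card P" using card_image by metis
  also have "\<dots> = q * p ^ (n + n * p ^ n)"
    by (simp add: P_def card_cartesian_product card_PiE N_nat power_add power_mult)
  finally show ?thesis .
qed

section \<open>The permutation group as a subgroup of \<open>affs\<close>\<close>

lemma s_aff:
  assumes "x \<in> X"
  shows "\<exists>u f. restrict (lmap r x) X = aff 1 u f"
proof -
  define f where "f c = - (\<alpha> * j (\<alpha> * (c - p2 x) - p1 x))" for c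
  have "s x y = mk (\<alpha> ^ 1 * p1 y + - (\<alpha> * p2 x)) (\<alpha> ^ 1 * p2 y + f (p1 y))" for y
    by (simp add: s_def f_def algebra_simps)
  then have "restrict (lmap r x) X = aff 1 (- (\<alpha> * p2 x)) f"
    unfolding aff_def by (intro restrict_ext) (simp only: lmap_r)
  then show ?thesis by blast
qed

lemma subgroup_G: "subgroup (carrier G) (BijGroup X)" and G_subset_affs: "carrier G \<subseteq> affs"
proof -
  interpret B: group "BijGroup X" by (rule group_BijGroup)
  have sub: "(\<lambda>x. restrict (lmap r x) X) ` X \<subseteq> affs" using s_aff by fastforce
  show "carrier G \<subseteq> affs"
    using B.generate_subgroup_incl[OF sub subgroup_affs] by (simp add: perm_group_def)
  show "subgroup (carrier G) (BijGroup X)"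
    using B.generate_is_subgroup[OF order_trans[OF sub subgroup.subset[OF subgroup_affs]]]
    by (simp add: perm_group_def)
qed

lemma order_G_dvd: "order G dvd q * p ^ (n + n * p ^ n)"
proof -
  interpret B: group "BijGroup X" by (rule group_BijGroup)
  interpret A: group "(BijGroup X)\<lparr>carrier := affs\<rparr>"
    by (rule B.subgroup_imp_group[OF subgroup_affs])
  have "subgroup (carrier G) ((BijGroup X)\<lparr>carrier := affs\<rparr>)"
    by (rule B.subgroup_incl[OF subgroup_G subgroup_affs G_subset_affs])
  then have "order G dvd order ((BijGroup X)\<lparr>carrier := affs\<rparr>)"
    unfolding order_def[of G] by (metis A.lagrange dvd_triv_right)
  also have "order ((BijGroup X)\<lparr>carrier := affs\<rparr>) = card affs"
    by (simp add: order_def)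
  finally show ?thesis by (simp only: card_affs)
qed

lemma group_G: "group G"
  using act.group_hom by (simp add: group_hom_def)

text \<open>The scalar of the \<open>k\<close>-th power of a generator is
  \<open>\<alpha> ^ k\<close>. Taking \<open>k\<close> to be the group order makes it trivial, and
  \<alpha> has order \<open>q\<close>.\<close>

lemma q_dvd_order_G: "q dvd order G"
proof -
  interpret G: group G by (rule group_G)
  have multG: "g \<otimes>\<^bsub>G\<^esub> h = g \<otimes>\<^bsub>BijGroup X\<^esub> h" and oneG: "\<one>\<^bsub>G\<^esub> = \<one>\<^bsub>BijGroup X\<^esub>" for g h
    by (simp_all add: perm_group_def)
  define g where "g = restrict (lmap r (mk 0 0)) X"
  have gG: "g \<in> carrier G" unfolding g_def by (rule gen_in_G) simp
  obtain u f where g: "g = aff 1 u f" using s_aff[of "mk 0 0"] by (auto simp: g_def)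
  have "\<exists>u f. g [^]\<^bsub>G\<^esub> k = aff k u f" for k :: nat
  proof (induction k)
    case 0
    show ?case by (auto simp: oneG BijGroup_one aff_0[symmetric])
  next
    case (Suc k)
    then obtain u' f' where "g [^]\<^bsub>G\<^esub> k = aff k u' f'" by blast
    then show ?case by (auto simp: multG g BijGroup_mult aff_Bij compose_aff)
  qed
  then obtain u' f' where "g [^]\<^bsub>G\<^esub> order G = aff (order G) u' f'" by blast
  moreover have "g [^]\<^bsub>G\<^esub> order G = aff 0 0 (\<lambda>_. 0)"
    using G.pow_order_eq_1[OF gG] by (simp add: oneG BijGroup_one aff_0)
  ultimately have "\<alpha> ^ order G \<doteq> \<alpha> ^ 0" using aff_eqD(1) by metis
  then show ?thesis by (simp add: \<alpha>_pow_iff)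
qed

lemma p_dvd_order_G: "p dvd order G"
proof -
  have "orbit G (\<lambda>g. g) (mk 0 0) = X"
  proof
    show "orbit G (\<lambda>g. g) (mk 0 0) \<subseteq> X"
      unfolding orbit_def using act.element_image[OF _ mk_in_X refl] by blast
    show "X \<subseteq> orbit G (\<lambda>g. g) (mk 0 0)"
    proof
      fix y assume "y \<in> X"
      then obtain g where "g \<in> carrier G" "g (mk 0 0) = y"
        using indecomposable_r mk_in_X unfolding indecomposable_solution_iff by blast
      then show "y \<in> orbit G (\<lambda>g. g) (mk 0 0)" unfolding orbit_def by blast
    qed
  qed
  then have "card X dvd order G"
    using act.orbit_stabilizer_theorem[of "mk 0 0"] by (metis dvd_triv_left mk_in_X)
  moreover have "p dvd card X" using n by (simp add: card_X)
  ultimately show ?thesis by (rule dvd_trans[rotated])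
qed

text \<open>Once \<open>q\<close> is split off, Lagrange leaves a divisor of a power of
  \<open>p\<close>. Its exponent is positive because \<open>p\<close> divides the order and differs
  from \<open>q\<close>.\<close>

lemma order_G: "\<exists>m > 0. order G = p ^ m * q"
proof -
  obtain t where t: "order G = q * t" using q_dvd_order_G by blast
  have "t dvd p ^ (n + n * p ^ n)" using order_G_dvd q(1) by (simp add: t)
  then obtain m where m: "t = p ^ m" using divides_primepow_nat[OF p(1)] by blast
  have "m > 0"
  proof (rule ccontr)
    assume "\<not> m > 0"
    then have "p dvd q" using p_dvd_order_G t m by simp
    then show False using p q primes_dvd_imp_eq by metis
  qed
  then show ?thesis using t m by (auto simp: mult.commute)
qed

lemma singular_r: "singular_solution X r"
  unfolding singular_solution_def
proof (intro conjI exI)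
  show "prime q" "q dvd order G" by (fact q(1), fact q_dvd_order_G)
  show "\<not> q dvd card X"
    using p q primes_dvd_imp_eq by (metis card_X prime_dvd_power)
qed (simp_all add: indecomposable_r)

end


theorem theorem4p2:
  fixes p n q :: nat
  assumes "prime p" "odd p" "\<not> fermat_prime p"
    and "n > 0"
    and "prime q" "odd q" "q dvd p - 1"
  shows "\<exists>(X :: nat set) r.
           simple_solution X r \<and> singular_solution X r \<and> card X = p ^ (2 * n) \<and>
           (\<exists>m > 0. order (perm_group X r) = p ^ m * q)"
proof -
  obtain a :: int where a: "[a ^ q = 1] (mod int p ^ n)" "\<not> [a = 1] (mod int p)"
    using ex_root_of_unity_mod_prime_power assms by blast
  \<comment> \<open>The inverse \<beta> of the root of unity is taken to be its power with exponent
    \<open>q - 1\<close>.\<close>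
  have "a * a ^ (q - 1) = a ^ q"
    using power_minus_mult[OF prime_gt_0_nat[OF assms(5)], of a] by (simp only: mult.commute)
  then have inverse: "[a * a ^ (q - 1) = 1] (mod int p ^ n)" using a(1) by simp
  have "q \<noteq> p"
    using assms(1,7) prime_gt_1_nat[of p] by (auto dest: dvd_imp_le)
  then interpret scalar_root p n q a "a ^ (q - 1)"
    using assms a inverse by unfold_locales auto
  show ?thesis using simple_r singular_r card_X order_G by blast
qed

end
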